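(* Let $\Omega=\{1,\dots,K\}$. If $g:2^\Omega\to\mathbb{R}_+$ satisfies the submodular property, i.e. $g(S)+g(T)\ge g(S\cap T)+g(S\cup T)$ for all $S,T\subseteq\Omega$, then the max-min fair point and the proportional fair point in $\mathcal{P}(g)=\{\mathbf{r}\in\mathbb{R}_+^K:\ \sum_{i\in S}r_i\le g(S)\ \ \forall S\subseteq\Omega\}$ coincide.
   Context: $\mathbb{R}_+$ denotes the nonnegative reals. A point $\mathbf{r}^{MM}\in\mathcal{R}$ of a set $\mathcal{R}\subseteq\mathbb{R}_+^K$ is max-min fair in $\mathcal{R}$ if for every $\mathbf{r}\in\mathcal{R}$ and every $i$ with $r_i>r_i^{MM}$ there is $j\in\Omega$ with $r_j<r_j^{MM}\le r_i^{MM}$. The proportional fair point of $\mathcal{R}$ is the point of $\mathcal{R}$ maximizing $\sum_{i=1}^K\log r_i$. *)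

theory Defs
  imports "HOL-Analysis.Analysis"
begin

text \<open>
  The index set \<open>{1..K}\<close> is represented by a finite type \<open>'n\<close> (with \<open>K = CARD('n)\<close>), so that
  points are vectors in \<^typ>\<open>real ^ 'n\<close> and set functions have type \<open>'n set \<Rightarrow> real\<close>.
\<close>

definition polymatroid_region :: "('n::finite set \<Rightarrow> real) \<Rightarrow> (real ^ 'n) set" where
  "polymatroid_region g = {r. (\<forall>i. 0 \<le> r $ i) \<and> (\<forall>S. (\<Sum>i\<in>S. r $ i) \<le> g S)}"

definition max_min_fair :: "(real ^ 'n::finite) set \<Rightarrow> real ^ 'n \<Rightarrow> bool" where
  "max_min_fair R m \<longleftrightarrow>
     m \<in> R \<and> (\<forall>r\<in>R. \<forall>i. r $ i > m $ i \<longrightarrow> (\<exists>j. r $ j < m $ j \<and> m $ j \<le> m $ i))"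

text \<open>
  Logarithm with \<open>log 0 = - \<infinity>\<close>. The library's \<^term>\<open>ln (0::real)\<close> is \<open>0\<close>, which would make points
  with vanishing coordinates spuriously good. The value at negative arguments is irrelevant here.
\<close>

definition log_ext :: "real \<Rightarrow> ereal" where
  "log_ext x = (if x > 0 then ereal (ln x) else - \<infinity>)"

definition log_utility :: "real ^ 'n::finite \<Rightarrow> ereal" where
  "log_utility r = (\<Sum>i\<in>UNIV. log_ext (r $ i))"

definition proportional_fair :: "(real ^ 'n::finite) set \<Rightarrow> real ^ 'n \<Rightarrow> bool" where
  "proportional_fair R p \<longleftrightarrow> is_arg_max log_utility (\<lambda>r. r \<in> R) p"

end

theory Submission
  imports Defs
begin

text \<open>
  Let \<open>x\<close> be the point of \<open>polymatroid_region g\<close> closest to a constant vector \<open>(M, \<dots>, M)\<close>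
  dominating the region. Its variational inequality forbids improving \<open>x\<close> by raising a coordinate
  or by moving mass from a larger to a smaller coordinate. By submodularity the tight sets
  (\<open>\<Sum>i\<in>S. x\<^sub>i = g S\<close>) are closed under union and intersection, so every \<open>i\<close> lies in a tight set
  on which \<open>x\<close> is at most \<open>x\<^sub>i\<close>. This gives max-min fairness, and shows that all
  sublevel sets of \<open>x\<close> are tight. Abel summation over these levels turns the tightness into
  \<open>(\<Sum>i. (r\<^sub>i - x\<^sub>i) / x\<^sub>i) \<le> 0\<close> for all \<open>r\<close> in the region, and \<open>ln t \<le> t - 1\<close> then yields
  proportional fairness.
\<close>

section \<open>Uniqueness and summation facts that hold outside polymatroids\<close>

lemma max_min_fair_unique:
  fixes x y :: "real ^ 'n::finite"
  assumes x: "max_min_fair R x" and y: "max_min_fair R y"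
  shows "x = y"
proof (rule ccontr)
  assume "x \<noteq> y"
  define N where "N = {i. x $ i \<noteq> y $ i}"
  have "finite N" "N \<noteq> {}"
    using \<open>x \<noteq> y\<close> by (auto simp: N_def vec_eq_iff)
  then obtain i where i: "i \<in> N"
    and least: "\<And>j. j \<in> N \<Longrightarrow> min (x $ i) (y $ i) \<le> min (x $ j) (y $ j)"
    using ex_is_arg_min_if_finite[of N "\<lambda>i. min (x $ i) (y $ i)"]
    unfolding is_arg_min_linorder by auto
  \<comment> \<open>Where \<open>u\<close> is smaller at \<open>i\<close>, fairness of
    \<open>u\<close> against \<open>v\<close> yields \<open>j\<close> with
    \<open>v $ j < u $ j \<le> u $ i\<close>: the points differ at \<open>j\<close> and their
    minimum there is below the least one. Stated for \<open>u\<close>, \<open>v\<close> to serve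
    both orders of \<open>x\<close> and \<open>y\<close>.\<close>
  have *: False
    if u: "max_min_fair R u" and v: "max_min_fair R v" and "u $ i < v $ i"
      and least': "\<And>j. u $ j \<noteq> v $ j \<Longrightarrow> min (u $ i) (v $ i) \<le> min (u $ j) (v $ j)" for u v
  proof -
    obtain j where "v $ j < u $ j" "u $ j \<le> u $ i"
      using u v \<open>u $ i < v $ i\<close> unfolding max_min_fair_def by blast
    then show False
      using least'[of j] \<open>u $ i < v $ i\<close> by auto
  qed
  consider "x $ i < y $ i" | "y $ i < x $ i"
    using i by (force simp: N_def)
  then show False
  proof cases
    case 1
    then show ?thesis using *[OF x y] least by (auto simp: N_def)
  next
    case 2
    have "min (y $ i) (x $ i) \<le> min (y $ j) (x $ j)" if "y $ j \<noteq> x $ j" for j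
      using least[of j] that by (simp add: N_def min.commute)
    then show ?thesis using *[OF y x] 2 by blast
  qed
qed

text \<open>Abel summation: nonnegative weights that decrease along \<open>f\<close> are nonnegative
  combinations of indicators of sublevel sets of \<open>f\<close>. The induction peels off the top
  level of \<open>f\<close>.\<close>

lemma sum_weighted_nonpos_if_sublevel_sums_nonpos:
  fixes f w d :: "'a \<Rightarrow> real"
  assumes "finite A"
    and "\<And>a. a \<in> A \<Longrightarrow> (\<Sum>i | i \<in> A \<and> f i \<le> f a. d i) \<le> 0"
    and "\<And>a. a \<in> A \<Longrightarrow> 0 \<le> w a"
    and "\<And>a b. a \<in> A \<Longrightarrow> b \<in> A \<Longrightarrow> f a \<le> f b \<Longrightarrow> w b \<le> w a"
  shows "(\<Sum>i\<in>A. w i * d i) \<le> 0"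
  using assms
proof (induction A arbitrary: w rule: finite_psubset_induct)
  case (psubset A)
  show ?case
  proof (cases "A = {}")
    case False
    then obtain m where m: "m \<in> A" "\<And>a. a \<in> A \<Longrightarrow> f a \<le> f m"
      using ex_is_arg_min_if_finite[OF psubset.hyps(1), of "\<lambda>a. - f a"]
      unfolding is_arg_min_linorder by auto
    define B where "B = {i \<in> A. f i < f m}"
    have B: "B \<subset> A" using m(1) by (auto simp: B_def)
    have top: "w i = w m" if "i \<in> A - B" for i
    proof (rule antisym)
      show "w i \<le> w m" using that m psubset.prems(3)[of m i] by (auto simp: B_def)
      show "w m \<le> w i" using that m psubset.prems(3)[of i m] by auto
    qed
    \<comment> \<open>Shifting by the least weight \<open>w m\<close> keeps the weights nonnegative
      and decreasing, and by \<open>top\<close> makes them vanish outside \<open>B\<close>. The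
      shift itself costs \<open>w m\<close> times the sum over all of \<open>A\<close>, the largest
      sublevel set.\<close>
    have "(\<Sum>i\<in>B. (w i - w m) * d i) \<le> 0"
    proof (rule psubset.IH[OF B])
      fix a assume a: "a \<in> B"
      have "{i. i \<in> B \<and> f i \<le> f a} = {i. i \<in> A \<and> f i \<le> f a}"
        using a by (auto simp: B_def)
      then show "(\<Sum>i | i \<in> B \<and> f i \<le> f a. d i) \<le> 0"
        using psubset.prems(1)[of a] a B by auto
      show "0 \<le> w a - w m"
        using a B m psubset.prems(3)[of a m] by auto
    next
      fix a b assume "a \<in> B" "b \<in> B" "f a \<le> f b"
      then show "w b - w m \<le> w a - w m"
        using psubset.prems(3)[of a b] B by auto
    qed
    also have "(\<Sum>i\<in>B. (w i - w m) * d i) = (\<Sum>i\<in>A. (w i - w m) * d i)"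
      by (rule sum.mono_neutral_left) (use psubset.hyps B top in auto)
    also have "\<dots> = (\<Sum>i\<in>A. w i * d i) - w m * (\<Sum>i\<in>A. d i)"
      by (simp add: left_diff_distrib sum_subtractf sum_distrib_left)
    finally have "(\<Sum>i\<in>A. w i * d i) \<le> w m * (\<Sum>i\<in>A. d i)" by simp
    moreover have "{i. i \<in> A \<and> f i \<le> f m} = A" using m by auto
    then have "(\<Sum>i\<in>A. d i) \<le> 0" using psubset.prems(1)[OF m(1)] by simp
    then have "w m * (\<Sum>i\<in>A. d i) \<le> 0"
      using psubset.prems(2)[OF m(1)] by (simp add: mult_nonneg_nonpos)
    ultimately show ?thesis by linarith
  qed simp
qed

section \<open>Logarithmic utility in the extended reals\<close>

lemma log_utility_eq_minus_infinity:
  assumes "r $ i \<le> 0"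
  shows "log_utility r = - \<infinity>"
proof -
  \<comment> \<open>On \<open>ereal\<close>, \<open>\<infinity> + - \<infinity>\<close> is
    \<open>\<infinity>\<close>, so \<open>- \<infinity>\<close> absorbs the other terms only once
    \<open>\<infinity>\<close> is excluded.\<close>
  have "(\<Sum>j\<in>UNIV - {i}. log_ext (r $ j)) \<noteq> \<infinity>"
    by (auto simp: sum_Pinfty log_ext_def)
  then have "log_ext (r $ i) + (\<Sum>j\<in>UNIV - {i}. log_ext (r $ j)) = - \<infinity>"
    using assms by (simp add: log_ext_def)
  then show ?thesis
    unfolding log_utility_def by (subst sum.remove[of _ i]) auto
qed

lemma log_utility_pos:
  assumes "\<And>i. 0 < r $ i"
  shows "log_utility r = ereal (\<Sum>i\<in>UNIV. ln (r $ i))"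
  unfolding log_utility_def log_ext_def using assms by simp

section \<open>Geometry of the region and its tight sets\<close>

lemma polymatroid_region_iff:
  "r \<in> polymatroid_region g \<longleftrightarrow> (\<forall>i. 0 \<le> r $ i) \<and> (\<forall>S. (\<Sum>i\<in>S. r $ i) \<le> g S)"
  by (simp add: polymatroid_region_def)

lemma closed_polymatroid_region: "closed (polymatroid_region g)"
proof -
  have "polymatroid_region g =
      (\<Inter>i. {r. 0 \<le> r $ i}) \<inter> (\<Inter>S. {r. (\<Sum>i\<in>S. r $ i) \<le> g S})"
    by (auto simp: polymatroid_region_iff)
  then show ?thesis
    by (auto intro!: closed_Int closed_INT closed_Collect_le continuous_intros)
qed

lemma convex_polymatroid_region: "convex (polymatroid_region g)"
proof (rule convexI)
  fix x y and u v :: real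
  assume *: "x \<in> polymatroid_region g" "y \<in> polymatroid_region g" "0 \<le> u" "0 \<le> v" "u + v = 1"
  have "(\<Sum>i\<in>S. u * x $ i + v * y $ i) \<le> g S" for S
  proof -
    have "(\<Sum>i\<in>S. u * x $ i + v * y $ i) = u * (\<Sum>i\<in>S. x $ i) + v * (\<Sum>i\<in>S. y $ i)"
      by (simp add: sum.distrib sum_distrib_left)
    also have "\<dots> \<le> u * g S + v * g S"
      using * by (intro add_mono mult_left_mono) (auto simp: polymatroid_region_iff)
    also have "\<dots> = g S" using * by (simp flip: distrib_right)
    finally show ?thesis .
  qed
  then show "u *\<^sub>R x + v *\<^sub>R y \<in> polymatroid_region g"
    using * by (auto simp: polymatroid_region_iff)
qed

lemma Inter_closed_finite:
  assumes "finite F" "F \<noteq> {}" "F \<subseteq> P"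
    and "\<And>S T. S \<in> P \<Longrightarrow> T \<in> P \<Longrightarrow> S \<inter> T \<in> P"
  shows "\<Inter>F \<in> P"
  using assms(1-3) by (induction rule: finite_ne_induct) (auto intro: assms(4))

lemma Union_closed_finite:
  assumes "finite F" "F \<noteq> {}" "F \<subseteq> P"
    and "\<And>S T. S \<in> P \<Longrightarrow> T \<in> P \<Longrightarrow> S \<union> T \<in> P"
  shows "\<Union>F \<in> P"
  using assms(1-3) by (induction rule: finite_ne_induct) (auto intro: assms(4))

definition tight_sets :: "('n::finite set \<Rightarrow> real) \<Rightarrow> real ^ 'n \<Rightarrow> 'n set set" where
  "tight_sets g x = {S. (\<Sum>i\<in>S. x $ i) = g S}"

text \<open>Coordinate sums are modular while \<open>g\<close> is submodular, so the slacks of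
  \<open>S \<inter> T\<close> and \<open>S \<union> T\<close> are nonnegative with total at most
  zero.\<close>

lemma tight_sets_Int_Un:
  fixes g :: "'n::finite set \<Rightarrow> real"
  assumes submodular: "\<And>S T. g S + g T \<ge> g (S \<inter> T) + g (S \<union> T)"
    and x: "x \<in> polymatroid_region g" and S: "S \<in> tight_sets g x" and T: "T \<in> tight_sets g x"
  shows "S \<inter> T \<in> tight_sets g x" "S \<union> T \<in> tight_sets g x"
proof -
  have "(\<Sum>i\<in>S \<union> T. x $ i) + (\<Sum>i\<in>S \<inter> T. x $ i) = g S + g T"
    using S T by (simp add: sum.union_inter tight_sets_def)
  moreover have "(\<Sum>i\<in>S \<union> T. x $ i) \<le> g (S \<union> T)" "(\<Sum>i\<in>S \<inter> T. x $ i) \<le> g (S \<inter> T)"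
    using x by (auto simp: polymatroid_region_iff)
  ultimately show "S \<inter> T \<in> tight_sets g x" "S \<union> T \<in> tight_sets g x"
    using submodular[of S T] by (auto simp: tight_sets_def)
qed

text \<open>There are finitely many constraints: those with slack survive a small step, and the
  binding ones are not worsened by \<open>v\<close>.\<close>

lemma feasible_direction:
  fixes g :: "'n::finite set \<Rightarrow> real"
  assumes x: "x \<in> polymatroid_region g"
    and coord: "\<And>i. v $ i < 0 \<Longrightarrow> 0 < x $ i"
    and tight: "\<And>S. S \<in> tight_sets g x \<Longrightarrow> (\<Sum>i\<in>S. v $ i) \<le> 0"
  obtains e where "0 < e" "x + e *\<^sub>R v \<in> polymatroid_region g"
proof -
  have ev: "\<forall>\<^sub>F e in at_right 0. a + e * b \<le> c" if "a \<le> c" "a = c \<Longrightarrow> b \<le> 0" for a b c :: real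
  proof (cases "a = c")
    case True
    show ?thesis
      using eventually_at_right_less[of "0::real"]
      by eventually_elim (use True that in \<open>auto simp: mult_nonneg_nonpos\<close>)
  next
    case False
    have "((\<lambda>e. a + e * b) \<longlongrightarrow> a + 0 * b) (at_right 0)"
      by (intro tendsto_intros)
    then have "\<forall>\<^sub>F e in at_right 0. a + e * b < c"
      using False that by (intro order_tendstoD) auto
    then show ?thesis by eventually_elim simp
  qed
  have "\<forall>\<^sub>F e in at_right 0. \<forall>i. - x $ i + e * - v $ i \<le> 0"
  proof (intro eventually_all_finite ev)
    fix i
    show "- x $ i \<le> 0" using x by (simp add: polymatroid_region_iff)
    show "- v $ i \<le> 0" if "- x $ i = 0" using coord[of i] that by force
  qed
  moreover have "\<forall>\<^sub>F e in at_right 0. \<forall>S. (\<Sum>i\<in>S. x $ i) + e * (\<Sum>i\<in>S. v $ i) \<le> g S"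
    by (intro eventually_all_finite ev)
      (use x tight in \<open>auto simp: polymatroid_region_iff tight_sets_def\<close>)
  ultimately have "\<forall>\<^sub>F e in at_right 0. 0 < e \<and> x + e *\<^sub>R v \<in> polymatroid_region g"
    using eventually_at_right_less[of "0::real"]
    by eventually_elim
      (auto simp: polymatroid_region_iff sum.distrib sum_distrib_left real_0_le_add_iff)
  then show thesis
    using that eventually_happens'[OF trivial_limit_at_right_real] by blast
qed

section \<open>Construction of the fair point by projection\<close>

lemma ex_tight_lower_sets:
  fixes g :: "'n::finite set \<Rightarrow> real"
  assumes nonneg: "\<And>S. 0 \<le> g S"
    and submodular: "\<And>S T. g S + g T \<ge> g (S \<inter> T) + g (S \<union> T)"
  obtains x where "x \<in> polymatroid_region g"
    and "\<And>i. \<exists>S\<in>tight_sets g x. i \<in> S \<and> (\<forall>j\<in>S. x $ j \<le> x $ i)"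
proof -
  let ?R = "polymatroid_region g"
  \<comment> \<open>Singleton constraints bound each coordinate by \<open>g {i}\<close>; the extra 1
    makes \<open>M\<close> strictly larger, so raising any coordinate of \<open>x\<close> slightly
    would approach \<open>a\<close>.\<close>
  define M where "M = 1 + (\<Sum>i\<in>UNIV. g {i})"
  define a :: "real ^ 'n" where "a = (\<chi> i. M)"
  define x where "x = closest_point ?R a"
  have "0 \<in> ?R" using nonneg by (simp add: polymatroid_region_iff)
  then have x: "x \<in> ?R"
    unfolding x_def by (intro closest_point_in_set closed_polymatroid_region) auto
  have "x $ i < M" for i
  proof -
    have "x $ i \<le> g {i}"
      using x by (auto simp: polymatroid_region_iff dest!: spec[of _ "{i}"])
    also have "\<dots> \<le> (\<Sum>i\<in>UNIV. g {i})"
      by (rule member_le_sum) (auto simp: nonneg)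
    finally show ?thesis by (simp add: M_def)
  qed
  then have below: "0 < (a - x) \<bullet> axis i 1" for i
    by (simp add: inner_axis a_def)
  have opt: "(a - x) \<bullet> v \<le> 0" if "0 < e" "x + e *\<^sub>R v \<in> ?R" for e v
    using closest_point_dot[OF convex_polymatroid_region closed_polymatroid_region that(2), of a]
      that(1) by (simp add: x_def[symmetric] mult_le_0_iff)
  have "\<exists>S\<in>tight_sets g x. i \<in> S \<and> (\<forall>j\<in>S. x $ j \<le> x $ i)" for i
  proof -
    define F where "F = {S \<in> tight_sets g x. i \<in> S}"
    have "F \<noteq> {}"
    proof
      assume "F = {}"
      then obtain e where "0 < e" "x + e *\<^sub>R axis i 1 \<in> ?R"
        by (rule_tac feasible_direction[OF x, of "axis i 1"])
          (auto simp: F_def axis_def split: if_splits)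
      with opt below[of i] show False by fastforce
    qed
    then have D: "\<Inter>F \<in> tight_sets g x"
      by (intro Inter_closed_finite tight_sets_Int_Un(1)[OF submodular x]) (auto simp: F_def)
    \<comment> \<open>\<open>\<Inter>F\<close> is the least tight set containing \<open>i\<close>,
      so every tight set with \<open>i\<close> also has \<open>j\<close>. Moving mass from
      \<open>j\<close> to \<open>i\<close> is then feasible if \<open>x $ j > x $ i\<close>, yet its
      inner product with \<open>a - x\<close> is \<open>x $ j - x $ i > 0\<close>.\<close>
    have "x $ j \<le> x $ i" if j: "j \<in> \<Inter>F" for j
    proof (rule ccontr)
      assume "\<not> x $ j \<le> x $ i"
      then have less: "x $ i < x $ j" "i \<noteq> j" by auto
      define v :: "real ^ 'n" where "v = axis i 1 - axis j 1"
      have sum_v: "(\<Sum>k\<in>S. v $ k) = of_bool (i \<in> S) - of_bool (j \<in> S)" for S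
        by (simp add: v_def axis_def sum_subtractf)
      obtain e where "0 < e" "x + e *\<^sub>R v \<in> ?R"
      proof (rule feasible_direction[OF x, of v])
        fix k assume "v $ k < 0"
        then have "k = j" by (auto simp: v_def axis_def split: if_splits)
        moreover have "0 \<le> x $ i" using x by (simp add: polymatroid_region_iff)
        ultimately show "0 < x $ k" using less by simp
      next
        fix S assume "S \<in> tight_sets g x"
        then show "(\<Sum>k\<in>S. v $ k) \<le> 0"
          using j by (auto simp: sum_v F_def)
      qed
      then have "(a - x) \<bullet> v \<le> 0" by (rule opt)
      then show False
        using less by (simp add: v_def inner_diff_right inner_axis a_def)
    qed
    then show ?thesis using D by (auto simp: F_def intro!: bexI[of _ "\<Inter>F"])
  qed
  with x show thesis using that by blast
qed

text \<open>Uniqueness of the maximizer is tied to a point with all coordinates positive: without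
  one, every point has utility \<open>- \<infinity>\<close> and all of them are maximizers.\<close>

theorem corollary12:
  fixes g :: "'n::finite set \<Rightarrow> real"
  assumes nonneg: "\<And>S. 0 \<le> g S"
    and submodular: "\<And>S T. g S + g T \<ge> g (S \<inter> T) + g (S \<union> T)"
  shows "\<exists>x. (\<forall>y. max_min_fair (polymatroid_region g) y \<longleftrightarrow> y = x) \<and>
             proportional_fair (polymatroid_region g) x \<and>
             ((\<exists>r\<in>polymatroid_region g. \<forall>i. 0 < r $ i) \<longrightarrow>
                (\<forall>y. proportional_fair (polymatroid_region g) y \<longleftrightarrow> y = x))"
proof -
  let ?R = "polymatroid_region g"
  obtain x where x: "x \<in> ?R"
    and lower: "\<And>i. \<exists>S\<in>tight_sets g x. i \<in> S \<and> (\<forall>j\<in>S. x $ j \<le> x $ i)"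
    using ex_tight_lower_sets[OF nonneg submodular] by metis
  have tight_le: "(\<Sum>i\<in>S. r $ i) \<le> (\<Sum>i\<in>S. x $ i)" if "r \<in> ?R" "S \<in> tight_sets g x" for r S
    using that by (simp add: polymatroid_region_iff tight_sets_def)

  have fair: "max_min_fair ?R x"
    unfolding max_min_fair_def
  proof (intro conjI ballI allI impI x)
    fix r i assume r: "r \<in> ?R" and i: "x $ i < r $ i"
    obtain S where S: "S \<in> tight_sets g x" "i \<in> S" "\<forall>j\<in>S. x $ j \<le> x $ i"
      using lower by blast
    have "\<exists>j\<in>S. r $ j < x $ j"
    proof (rule ccontr)
      assume "\<not> ?thesis"
      then have "(\<Sum>j\<in>S. x $ j) < (\<Sum>j\<in>S. r $ j)"
        using S(2) i by (intro sum_strict_mono_ex1) (auto simp: not_less)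
      with tight_le[OF r S(1)] show False by simp
    qed
    then show "\<exists>j. r $ j < x $ j \<and> x $ j \<le> x $ i" using S(3) by blast
  qed
  have mmf: "max_min_fair ?R y \<longleftrightarrow> y = x" for y
    using fair max_min_fair_unique by blast

  show ?thesis
  proof (cases "\<forall>i. 0 < x $ i")
    case False
    then obtain i where i: "x $ i \<le> 0" by (auto simp: not_less)
    obtain S where S: "S \<in> tight_sets g x" "i \<in> S" "\<forall>j\<in>S. x $ j \<le> x $ i"
      using lower by blast
    \<comment> \<open>A vanishing \<open>x $ i\<close> forces \<open>x\<close> to vanish on the
      tight set \<open>S\<close>, which caps coordinate \<open>i\<close> of every point at
      zero.\<close>
    have zero: "r $ i \<le> 0" if r: "r \<in> ?R" for r
    proof -
      have "r $ i \<le> (\<Sum>j\<in>S. r $ j)"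
        using r S(2) by (intro member_le_sum) (auto simp: polymatroid_region_iff)
      also have "\<dots> \<le> (\<Sum>j\<in>S. x $ j)" by (rule tight_le[OF r S(1)])
      also have "\<dots> \<le> 0" using S(3) i by (intro sum_nonpos) force
      finally show ?thesis .
    qed
    then have "log_utility r = - \<infinity>" if "r \<in> ?R" for r
      using that log_utility_eq_minus_infinity by blast
    then have "proportional_fair ?R x"
      using x by (simp add: proportional_fair_def is_arg_max_def)
    moreover have "\<not> (\<exists>r\<in>?R. \<forall>i. 0 < r $ i)" using zero by (meson not_less)
    ultimately show ?thesis using mmf by blast
  next
    case True
    then have pos: "0 < x $ i" for i by blast
    have sublevel: "{i. x $ i \<le> c} \<in> tight_sets g x" if "x $ a = c" for a c
    proof -
      define F where "F = {S \<in> tight_sets g x. \<forall>j\<in>S. x $ j \<le> c}"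
      have "F \<noteq> {}" using lower[of a] that by (auto simp: F_def)
      then have "\<Union>F \<in> tight_sets g x"
        by (intro Union_closed_finite tight_sets_Int_Un(2)[OF submodular x]) (auto simp: F_def)
      moreover have "\<Union>F = {i. x $ i \<le> c}"
      proof
        show "{i. x $ i \<le> c} \<subseteq> \<Union>F"
        proof
          fix i assume i: "i \<in> {i. x $ i \<le> c}"
          obtain S where "S \<in> tight_sets g x" "i \<in> S" "\<forall>j\<in>S. x $ j \<le> x $ i"
            using lower by blast
          with i show "i \<in> \<Union>F" by (fastforce simp: F_def)
        qed
      qed (auto simp: F_def)
      ultimately show ?thesis by simp
    qed
    \<comment> \<open>First-order optimality of the log sum at \<open>x\<close>: the weights
      \<open>1 / x $ i\<close> decrease in \<open>x $ i\<close>, and tightness of sublevel sets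
      bounds the partial sums of \<open>r - x\<close>.\<close>
    have gradient: "(\<Sum>i\<in>UNIV. 1 / x $ i * (r $ i - x $ i)) \<le> 0" if r: "r \<in> ?R" for r
    proof (rule sum_weighted_nonpos_if_sublevel_sums_nonpos[where f = "\<lambda>i. x $ i"])
      fix a
      show "(\<Sum>i | i \<in> UNIV \<and> x $ i \<le> x $ a. r $ i - x $ i) \<le> 0"
        using tight_le[OF r sublevel[of a]] by (simp add: sum_subtractf)
    qed (use pos in \<open>auto simp: frac_le less_imp_le\<close>)
    have best: "log_utility r < log_utility x" if r: "r \<in> ?R" "r \<noteq> x" for r
    proof (cases "\<forall>i. 0 < r $ i")
      case True
      then have r_pos: "0 < r $ i" for i by blast
      have ln_le: "ln (r $ i) - ln (x $ i) \<le> 1 / x $ i * (r $ i - x $ i)" for i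
        using ln_le_minus_one[of "r $ i / x $ i"] r_pos[of i] pos[of i]
        by (simp add: ln_div diff_divide_distrib split: if_splits)
      obtain k where k: "r $ k \<noteq> x $ k" using r(2) by (auto simp: vec_eq_iff)
      \<comment> \<open>\<open>ln t = t - 1\<close> only at \<open>t = 1\<close>; a differing
        coordinate makes the bound strict, hence the maximizer unique.\<close>
      have "ln (r $ k) - ln (x $ k) \<noteq> 1 / x $ k * (r $ k - x $ k)"
        using ln_eq_minus_one[of "r $ k / x $ k"] r_pos[of k] k pos[of k]
        by (auto simp: ln_div diff_divide_distrib)
      then have "ln (r $ k) - ln (x $ k) < 1 / x $ k * (r $ k - x $ k)"
        using ln_le[of k] by linarith
      then have "(\<Sum>i\<in>UNIV. ln (r $ i) - ln (x $ i)) < (\<Sum>i\<in>UNIV. 1 / x $ i * (r $ i - x $ i))"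
        using ln_le by (intro sum_strict_mono_ex1) auto
      also have "\<dots> \<le> 0" by (rule gradient[OF r(1)])
      finally show ?thesis
        using r_pos pos by (simp add: log_utility_pos sum_subtractf)
    next
      case False
      then obtain i where "r $ i \<le> 0" by (auto simp: not_less)
      then show ?thesis
        using pos by (simp add: log_utility_eq_minus_infinity log_utility_pos)
    qed
    then have "proportional_fair ?R y \<longleftrightarrow> y = x" for y
      using x unfolding proportional_fair_def is_arg_max_def
      by (metis less_asym less_irrefl)
    then show ?thesis using mmf by blast
  qed
qed

end
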